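(* Let $N$ be an even positive integer, let $x_i:=i/N$ for $i=0,1,\dots,N$, and let $$X_{2j-1}:=X_{2j}:=\Bigl[\tfrac{2(j-1)}{N},\tfrac{2j}{N}\Bigr],\quad j=1,\dots,N/2 .$$ Let $u_i:X_i\to[0,1]$ be the affine maps $u_{2j-1}(x)=\frac{x}{2}+\frac{j-1}{N}$ and $u_{2j}(x)=\frac{x}{2}+\frac{j}{N}$, so that $u_i(X_i)=[\frac{i-1}{N},\frac{i}{N}]$, $i=1,\dots,N$. Let $y_0,\dots,y_{N/2}\in\mathbb{R}$, $\mathscr{I}:=\{(x_{2j},y_j): j=0,\dots,N/2\}$, and $C_{\mathscr{I}}:=\{f\in C[0,1] : f(x_{2j})=y_j,\ j=0,1,\dots,N/2\}$, with the supremum metric. Let $\lambda_i,S_i\in C(X_i)$, $i=1,\dots,N$, have property (J): for all $j=1,\dots,N/2$, $$\lambda_{2j-1}(x_{2(j-1)})+\bigl(S_{2j-1}(x_{2(j-1)})-1\bigr)y_{j-1}=0,\qquad \lambda_{2j}(x_{2j})+\bigl(S_{2j}(x_{2j})-1\bigr)y_j=0,$$ $$\lambda_{2j}(x_{2(j-1)})+S_{2j}(x_{2(j-1)})\,y_{j-1}=\lambda_{2j-1}(x_{2j})+S_{2j-1}(x_{2j})\,y_j .$$ Then the operator $\Phi$ given by $$(\Phi f)(u_i(x))=\lambda_i(x)+S_i(x)f(x),\qquad x\in X_i,\ i=1,\dots,N,$$ is well defined on $C_{\mathscr{I}}$ and maps $C_{\mathscr{I}}$ into itself. If, in addition, $\max\{\|S_i\|_{\infty,X_i}: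 i=1,\dots,N\}<1$, then $\Phi$ is a contraction and thus possesses a unique fixed point $\mathfrak{f}:[0,1]\to\mathbb{R}$ satisfying $\mathfrak{f}(x_{2j})=y_j$ for all $j=0,1,\dots,N/2$.
   Context: $C(X_i)$ is the space of real-valued continuous functions on $X_i$ and $C[0,1]$ that of continuous functions on $[0,1]$ with the supremum norm; $\|\cdot\|_{\infty,X_i}$ is the supremum norm on $X_i$. *)

theory Defs
  imports "HOL-Analysis.Analysis"
begin

definition knot :: "nat \<Rightarrow> nat \<Rightarrow> real" where
  "knot N i = real i / real N"

text \<open>The index \<open>i \<ge> 1\<close> is written as \<open>2 * j - 1\<close> or \<open>2 * j\<close> with \<open>j = (i + 1) div 2\<close>.\<close>

definition subdom :: "nat \<Rightarrow> nat \<Rightarrow> real set" where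
  "subdom N i = (let j = (i + 1) div 2 in {2 * (real j - 1) / real N .. 2 * real j / real N})"

definition umap :: "nat \<Rightarrow> nat \<Rightarrow> real \<Rightarrow> real" where
  "umap N i x = (let j = (i + 1) div 2 in
     if odd i then x / 2 + (real j - 1) / real N else x / 2 + real j / real N)"

lemma subdom_pair:
  assumes "j \<ge> 1"
  shows "subdom N (2 * j - 1) = {knot N (2 * (j - 1)) .. knot N (2 * j)}"
    and "subdom N (2 * j) = {knot N (2 * (j - 1)) .. knot N (2 * j)}"
  using assms by (simp_all add: subdom_def knot_def Let_def of_nat_diff algebra_simps)

lemma umap_pair:
  assumes "j \<ge> 1"
  shows "umap N (2 * j - 1) x = x / 2 + (real j - 1) / real N"
    and "umap N (2 * j) x = x / 2 + real j / real N"
  using assms by (simp_all add: umap_def)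

lemma umap_image:
  assumes "i \<ge> 1"
  shows "umap N i ` subdom N i = {(real i - 1) / real N .. real i / real N}"
proof -
  define j where "j = (i + 1) div 2"
  define b where "b = (if odd i then real j - 1 else real j)"
  have u: "umap N i = (\<lambda>x. (1/2) *\<^sub>R x + b / real N)"
    by (auto simp: umap_def b_def j_def Let_def)
  have d: "subdom N i = cbox (2 * (real j - 1) / real N) (2 * real j / real N)"
    by (simp add: subdom_def j_def Let_def)
  have ne: "2 * (real j - 1) / real N \<le> 2 * real j / real N"
    by (intro divide_right_mono) auto
  have "(real j - 1) + b = real i - 1 \<and> real j + b = real i"
  proof (cases "odd i")
    case True
    then obtain k where "i = 2 * k + 1" by (elim oddE)
    then show ?thesis by (simp add: b_def j_def)
  next
    case False
    then obtain k where "i = 2 * k" by (auto elim: evenE)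
    then show ?thesis by (simp add: b_def j_def)
  qed
  moreover have "umap N i ` subdom N i
      = {(real j - 1) / real N + b / real N .. real j / real N + b / real N}"
    using ne unfolding u d
    by (subst image_affinity_cbox) (cases "N = 0"; simp add: field_simps)
  ultimately show ?thesis by (metis add_divide_distrib)
qed

text \<open>Elements of \<open>C[0,1]\<close> are functions on \<open>[0,1]\<close>: they are \<^const>\<open>extensional\<close>,
  i.e. they take the value \<^const>\<open>undefined\<close> outside of the unit interval.\<close>

abbreviation C01 :: "(real \<Rightarrow> real) metric" where
  "C01 \<equiv> cfunspace (top_of_set {0..1}) euclidean_metric"

definition interp_space :: "nat \<Rightarrow> (nat \<Rightarrow> real) \<Rightarrow> (real \<Rightarrow> real) metric" where
  "interp_space N y = submetric C01 {f. \<forall>j \<le> N div 2. f (knot N (2 * j)) = y j}"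

lemma mspace_interp_space:
  "mspace (interp_space N y) =
     {f \<in> extensional {0..1}. continuous_on {0..1} f \<and> (\<forall>j \<le> N div 2. f (knot N (2 * j)) = y j)}"
proof -
  have "Metric_space.mbounded UNIV dist (f ` {0..1})"
    if "continuous_on {0..1} f" for f :: "real \<Rightarrow> real"
    using compact_continuous_image[OF that] compact_imp_bounded by auto
  then show ?thesis
    by (auto simp: interp_space_def)
qed

lemma mdist_interp_space:
  assumes "f \<in> mspace (interp_space N y)" "g \<in> mspace (interp_space N y)"
  shows "mdist (interp_space N y) f g = (SUP x\<in>{0..1}. \<bar>f x - g x\<bar>)"
proof -
  have "f \<in> mspace (funspace {0..1} euclidean_metric)" "g \<in> mspace (funspace {0..1} euclidean_metric)"
    using assms cfunspace_subset_funspace[of "top_of_set {0..1::real}" "euclidean_metric :: real metric"]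
    by (auto simp: interp_space_def simp del: mspace_cfunspace mspace_funspace)
  then show ?thesis
    by (simp add: Metric_space.fdist_def[OF Met_TC.Metric_space_axioms] interp_space_def mdist_cfunspace_eq_mdist_funspace dist_real_def)
qed

definition sup_norm :: "real set \<Rightarrow> (real \<Rightarrow> real) \<Rightarrow> real" where
  "sup_norm X f = (SUP x\<in>X. \<bar>f x\<bar>)"

definition property_J ::
  "nat \<Rightarrow> (nat \<Rightarrow> real) \<Rightarrow> (nat \<Rightarrow> real \<Rightarrow> real) \<Rightarrow> (nat \<Rightarrow> real \<Rightarrow> real) \<Rightarrow> bool" where
  "property_J N y lam S \<longleftrightarrow> (\<forall>j\<in>{1..N div 2}.
     lam (2 * j - 1) (knot N (2 * (j - 1)))
       + (S (2 * j - 1) (knot N (2 * (j - 1))) - 1) * y (j - 1) = 0 \<and>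
     lam (2 * j) (knot N (2 * j)) + (S (2 * j) (knot N (2 * j)) - 1) * y j = 0 \<and>
     lam (2 * j) (knot N (2 * (j - 1))) + S (2 * j) (knot N (2 * (j - 1))) * y (j - 1)
       = lam (2 * j - 1) (knot N (2 * j)) + S (2 * j - 1) (knot N (2 * j)) * y j)"

definition Phi_rel ::
  "nat \<Rightarrow> (nat \<Rightarrow> real \<Rightarrow> real) \<Rightarrow> (nat \<Rightarrow> real \<Rightarrow> real) \<Rightarrow> (real \<Rightarrow> real) \<Rightarrow> (real \<Rightarrow> real) \<Rightarrow> bool" where
  "Phi_rel N lam S f g \<longleftrightarrow> g \<in> extensional {0..1} \<and>
     (\<forall>i\<in>{1..N}. \<forall>x\<in>subdom N i. g (umap N i x) = lam i x + S i x * f x)"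

text \<open>The defining equations overlap at the end points of the intervals \<open>u\<^sub>i(X\<^sub>i)\<close>;
  \<open>Phi\<close> is meaningful only where \<^const>\<open>Phi_rel\<close> determines exactly one function.\<close>

definition Phi ::
  "nat \<Rightarrow> (nat \<Rightarrow> real \<Rightarrow> real) \<Rightarrow> (nat \<Rightarrow> real \<Rightarrow> real) \<Rightarrow> (real \<Rightarrow> real) \<Rightarrow> (real \<Rightarrow> real)" where
  "Phi N lam S f = (THE g. Phi_rel N lam S f g)"

definition contraction :: "'a metric \<Rightarrow> ('a \<Rightarrow> 'a) \<Rightarrow> bool" where
  "contraction m T \<longleftrightarrow> T \<in> mspace m \<rightarrow> mspace m \<and>
     (\<exists>k. 0 \<le> k \<and> k < 1 \<and> (\<forall>f\<in>mspace m. \<forall>g\<in>mspace m. mdist m (T f) (T g) \<le> k * mdist m f g))"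

end

theory Submission
  imports Defs
begin

text \<open>
  Up to the change of variable \<open>x = u\<^sub>i(t)\<close>, the functional equation prescribes \<open>\<Phi> f\<close> separately
  on each of the \<open>N\<close> cells \<open>u\<^sub>i(X\<^sub>i) = [(i - 1)/N, i/N]\<close>, which cover \<open>[0,1]\<close>; so it has at most
  one solution on \<open>[0,1]\<close>. Two different cells meet only if they are neighbours, and then in a single
  point \<open>i/N\<close>. There the two prescriptions agree, and this is what property (J) says: for
  odd \<open>i = 2j - 1\<close> the point is the common image of the right end of \<open>X\<^sub>2\<^sub>j\<^sub>-\<^sub>1\<close> and of the left end of
  \<open>X\<^sub>2\<^sub>j\<close>, which is the third equation; for even \<open>i = 2j\<close> the point is the interpolation knot \<open>x\<^sub>2\<^sub>j\<close>,
  which both \<open>u\<^sub>2\<^sub>j\<close> and \<open>u\<^sub>2\<^sub>j\<^sub>+\<^sub>1\<close> fix, and the first two equations give both sides the value \<open>y\<^sub>j\<close>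
  (\<open>cell_values_agree\<close>). Hence the continuous prescriptions on the finitely many closed cells paste
  to one continuous function (\<open>Phi_rel_continuous_solution\<close>), and by the same two equations it
  interpolates again (\<open>Phi_rel_interpolates\<close>).

  The terms \<open>\<lambda>\<^sub>i\<close> cancel in \<open>\<Phi> f - \<Phi> g\<close>, so \<open>\<Phi>\<close> is Lipschitz with the largest of the norms
  \<open>\<parallel>S\<^sub>i\<parallel>\<close> as its constant (\<open>Phi_rel_Lipschitz\<close>). The interpolation conditions cut out a closed
  subset of the complete space \<open>C[0,1]\<close>, and it is inhabited by a combination of hat functions, so
  the Banach fixed point theorem applies.
\<close>

section \<open>The cells of the unit interval\<close>

lemma knot_in_unit_interval: "i \<le> N \<Longrightarrow> knot N i \<in> {0..1}"
  by (cases "N = 0") (auto simp: knot_def)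

lemma even_knot_in_unit_interval: "j \<le> N div 2 \<Longrightarrow> knot N (2 * j) \<in> {0..1}"
  by (rule knot_in_unit_interval) linarith

text \<open>The parity of \<open>i\<close> enters all definitions; this is the case distinction in terms of \<open>j\<close>.
  Evenness of \<open>N\<close> ensures that \<open>i = 2j - 1 \<le> N\<close> implies \<open>2j \<le> N\<close>.\<close>

lemma index_cases:
  fixes i N :: nat
  assumes "even N" "i \<in> {1..N}"
  obtains j where "j \<in> {1..N div 2}" "i = 2 * j - 1" "odd i"
        | j where "j \<in> {1..N div 2}" "i = 2 * j" "even i"
proof (cases "odd i")
  case True
  then obtain k where k: "i = 2 * k + 1" by (elim oddE)
  then have "k + 1 \<in> {1..N div 2}" using assms by (auto elim!: evenE)
  then show ?thesis using that(1)[of "k + 1"] k True by auto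
next
  case False
  then obtain k where "i = 2 * k" by (auto elim: evenE)
  then show ?thesis using that(2)[of k] assms False by auto
qed

lemma subdom_subset_unit_interval:
  assumes "even N" "i \<in> {1..N}"
  shows "subdom N i \<subseteq> {0..1}"
  using assms
proof (cases rule: index_cases)
  case (1 j)
  then show ?thesis
    using even_knot_in_unit_interval[of j N] even_knot_in_unit_interval[of "j - 1" N]
      subdom_pair(1)[of j N] by auto
next
  case (2 j)
  then show ?thesis
    using even_knot_in_unit_interval[of j N] even_knot_in_unit_interval[of "j - 1" N]
      subdom_pair(2)[of j N] by auto
qed

lemma unit_interval_covered:
  assumes "N > 0" "x \<in> {0..1}"
  obtains i where "i \<in> {1..N}" "x \<in> {(real i - 1) / real N .. real i / real N}"
proof (cases "x = 0")
  case True
  then show ?thesis using that[of 1] assms by auto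
next
  case False
  define i where "i = nat \<lceil>real N * x\<rceil>"
  have pos: "real N * x > 0" using False assms by auto
  have "real N * x \<le> real N" using assms by (simp add: mult_left_le)
  then have "i \<in> {1..N}" using pos unfolding i_def by (auto simp: nat_le_iff ceiling_le_iff) linarith
  moreover have "real i - 1 \<le> real N * x" "real N * x \<le> real i"
    using pos unfolding i_def by linarith+
  ultimately show ?thesis using that[of i] assms by (auto simp: field_simps)
qed

lemma cell_subset_unit_interval:
  "i \<in> {1..N} \<Longrightarrow> {(real i - 1) / real N .. real i / real N} \<subseteq> {0..1}"
  by (auto simp: divide_simps mult_le_0_iff intro: order_trans)

text \<open>The inverse of the affine map \<open>u\<^sub>i\<close>, which has slope \<open>1/2\<close>.\<close>

definition umap_inv :: "nat \<Rightarrow> nat \<Rightarrow> real \<Rightarrow> real" where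
  "umap_inv N i x = 2 * (x - umap N i 0)"

lemma umap_inv_umap [simp]: "umap_inv N i (umap N i t) = t"
  by (auto simp: umap_inv_def umap_def Let_def)

lemma umap_inv_in_subdom:
  assumes "i \<ge> 1" "x \<in> {(real i - 1) / real N .. real i / real N}"
  shows "umap_inv N i x \<in> subdom N i"
  using assms umap_image[of i N] by (metis imageE umap_inv_umap)

lemma umap_knots:
  assumes "j \<ge> 1"
  shows "umap N (2 * j - 1) (knot N (2 * (j - 1))) = knot N (2 * (j - 1))"
    and "umap N (2 * j - 1) (knot N (2 * j)) = knot N (2 * j - 1)"
    and "umap N (2 * j) (knot N (2 * (j - 1))) = knot N (2 * j - 1)"
    and "umap N (2 * j) (knot N (2 * j)) = knot N (2 * j)"
  using assms unfolding umap_pair[OF assms] knot_def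
  by (simp_all add: of_nat_diff diff_divide_distrib add_divide_distrib)

lemma umap_inv_knots:
  assumes "j \<ge> 1"
  shows "umap_inv N (2 * j - 1) (knot N (2 * (j - 1))) = knot N (2 * (j - 1))"
    and "umap_inv N (2 * j - 1) (knot N (2 * j - 1)) = knot N (2 * j)"
    and "umap_inv N (2 * j) (knot N (2 * j - 1)) = knot N (2 * (j - 1))"
    and "umap_inv N (2 * j) (knot N (2 * j)) = knot N (2 * j)"
  using umap_knots[OF assms, of N] umap_inv_umap by metis+

section \<open>The operator on the interpolation space\<close>

text \<open>The value that the functional equation prescribes for \<open>\<Phi> f\<close> at a point \<open>x\<close> of the \<open>i\<close>-th cell,
  solved for \<open>x = u\<^sub>i(t)\<close>.\<close>

definition cell_value ::
  "nat \<Rightarrow> (nat \<Rightarrow> real \<Rightarrow> real) \<Rightarrow> (nat \<Rightarrow> real \<Rightarrow> real) \<Rightarrow> (real \<Rightarrow> real) \<Rightarrow> nat \<Rightarrow> real \<Rightarrow> real" where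
  "cell_value N lam S f i x =
     lam i (umap_inv N i x) + S i (umap_inv N i x) * f (umap_inv N i x)"

lemma Phi_rel_iff_cell_value:
  "Phi_rel N lam S f g \<longleftrightarrow> g \<in> extensional {0..1} \<and>
     (\<forall>i\<in>{1..N}. \<forall>x\<in>{(real i - 1) / real N .. real i / real N}. g x = cell_value N lam S f i x)"
proof -
  have "(\<forall>x\<in>subdom N i. g (umap N i x) = lam i x + S i x * f x) \<longleftrightarrow>
        (\<forall>x\<in>{(real i - 1) / real N .. real i / real N}. g x = cell_value N lam S f i x)"
    if "i \<in> {1..N}" for i
    using umap_image[of i N] that by (auto simp: cell_value_def simp flip: umap_image)
  then show ?thesis by (simp add: Phi_rel_def)
qed

lemma Phi_rel_unique:
  assumes "N > 0" "Phi_rel N lam S f g" "Phi_rel N lam S f h"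
  shows "g = h"
proof
  fix x
  show "g x = h x"
  proof (cases "x \<in> {0..1}")
    case True
    with \<open>N > 0\<close> obtain i where "i \<in> {1..N}" "x \<in> {(real i - 1) / real N .. real i / real N}"
      by (rule unit_interval_covered)
    then show ?thesis using assms(2,3) by (simp add: Phi_rel_iff_cell_value)
  next
    case False
    then show ?thesis using assms(2,3) unfolding Phi_rel_def by (metis extensional_arb)
  qed
qed

lemma Phi_eqI:
  assumes "N > 0" "Phi_rel N lam S f g"
  shows "Phi N lam S f = g"
  unfolding Phi_def using assms Phi_rel_unique by (intro the_equality) auto

text \<open>Both end points of \<open>X\<^sub>2\<^sub>j\<^sub>-\<^sub>1 = X\<^sub>2\<^sub>j\<close> are interpolation knots, where \<open>f\<close> has a known value; this
  is how (J), which mentions only the data \<open>y\<close>, speaks about \<open>\<Phi> f\<close>.\<close>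

lemma cell_values_at_knots:
  assumes "property_J N y lam S" and f: "\<And>j. j \<le> N div 2 \<Longrightarrow> f (knot N (2 * j)) = y j"
    and j: "j \<in> {1..N div 2}"
  shows "cell_value N lam S f (2 * j - 1) (knot N (2 * (j - 1))) = y (j - 1)"
    and "cell_value N lam S f (2 * j) (knot N (2 * j)) = y j"
    and "cell_value N lam S f (2 * j - 1) (knot N (2 * j - 1))
       = cell_value N lam S f (2 * j) (knot N (2 * j - 1))"
proof -
  have fj: "f (knot N (2 * j)) = y j" "f (knot N (2 * (j - 1))) = y (j - 1)"
    using j by (auto intro!: f)
  have J: "lam (2 * j - 1) (knot N (2 * (j - 1)))
       + (S (2 * j - 1) (knot N (2 * (j - 1))) - 1) * y (j - 1) = 0"
     "lam (2 * j) (knot N (2 * j)) + (S (2 * j) (knot N (2 * j)) - 1) * y j = 0"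
     "lam (2 * j) (knot N (2 * (j - 1))) + S (2 * j) (knot N (2 * (j - 1))) * y (j - 1)
       = lam (2 * j - 1) (knot N (2 * j)) + S (2 * j - 1) (knot N (2 * j)) * y j"
    using assms(1) j unfolding property_J_def by blast+
  have j1: "j \<ge> 1" using j by simp
  show "cell_value N lam S f (2 * j - 1) (knot N (2 * (j - 1))) = y (j - 1)"
    using J(1) unfolding cell_value_def umap_inv_knots[OF j1] fj by (simp add: left_diff_distrib)
  show "cell_value N lam S f (2 * j) (knot N (2 * j)) = y j"
    using J(2) unfolding cell_value_def umap_inv_knots[OF j1] fj by (simp add: left_diff_distrib)
  show "cell_value N lam S f (2 * j - 1) (knot N (2 * j - 1))
       = cell_value N lam S f (2 * j) (knot N (2 * j - 1))"
    using J(3) unfolding cell_value_def umap_inv_knots[OF j1] fj by simp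
qed

text \<open>Two distinct cells that share a point are neighbours \<open>i\<close> and \<open>i + 1\<close> and share only the point
  \<open>i/N\<close>. For odd \<open>i\<close> it is the midpoint of some \<open>X\<^sub>2\<^sub>j\<close>; for even \<open>i\<close> it is a knot, and both cells give
  it the same datum.\<close>

lemma cell_values_agree:
  assumes "even N" "property_J N y lam S" "\<And>j. j \<le> N div 2 \<Longrightarrow> f (knot N (2 * j)) = y j"
    and "i \<in> {1..N}" "k \<in> {1..N}"
    and "x \<in> {(real i - 1) / real N .. real i / real N}"
    and "x \<in> {(real k - 1) / real N .. real k / real N}"
  shows "cell_value N lam S f i x = cell_value N lam S f k x"
  using assms(4-)
proof (induction i k rule: linorder_wlog)
  case (sym i k)
  then show ?case by auto
next
  case (le i k)
  note knots = cell_values_at_knots[OF assms(2,3)]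
  show ?case
  proof (cases "i = k")
    case False
    have "N > 0" using le by simp
    have "(real k - 1) / real N \<le> real i / real N" using le by auto
    then have "real k - 1 \<le> real i" using \<open>N > 0\<close> by (simp add: divide_le_cancel)
    then have k: "k = i + 1" using le False by linarith
    then have x: "x = knot N i" using le by (auto simp: knot_def)
    from \<open>even N\<close> \<open>i \<in> {1..N}\<close> show ?thesis
    proof (cases rule: index_cases)
      case (1 j)
      then have "k = 2 * j" using k by simp
      then show ?thesis using knots(3)[of j] 1 x by simp
    next
      case (2 j)
      then have "j + 1 \<in> {1..N div 2}" using k le \<open>even N\<close> by (auto elim!: evenE)
      then show ?thesis using knots(1)[of "j + 1"] knots(2)[of j] 2 x k by simp
    qed
  qed simp
qed

lemma continuous_on_cell_value:
  assumes "even N" "i \<in> {1..N}" "continuous_on (subdom N i) (lam i)"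
    "continuous_on (subdom N i) (S i)" "continuous_on {0..1} f"
  shows "continuous_on {(real i - 1) / real N .. real i / real N} (cell_value N lam S f i)"
proof -
  let ?I = "{(real i - 1) / real N .. real i / real N}"
  have inv: "continuous_on ?I (umap_inv N i)"
    unfolding umap_inv_def by (intro continuous_intros)
  have sub: "umap_inv N i ` ?I \<subseteq> subdom N i" using umap_inv_in_subdom assms(2) by auto
  then have sub': "umap_inv N i ` ?I \<subseteq> {0..1}"
    using subdom_subset_unit_interval assms(1,2) by blast
  show ?thesis
    unfolding cell_value_def
    by (intro continuous_on_add continuous_on_mult
        continuous_on_compose2[OF assms(3) inv sub] continuous_on_compose2[OF assms(4) inv sub]
        continuous_on_compose2[OF assms(5) inv sub'])
qed

lemma Phi_rel_continuous_solution:
  assumes "even N" "N > 0"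
    and lam: "\<And>i. i \<in> {1..N} \<Longrightarrow> continuous_on (subdom N i) (lam i)"
    and S: "\<And>i. i \<in> {1..N} \<Longrightarrow> continuous_on (subdom N i) (S i)"
    and J: "property_J N y lam S"
    and f: "continuous_on {0..1} f" "\<And>j. j \<le> N div 2 \<Longrightarrow> f (knot N (2 * j)) = y j"
  obtains g where "Phi_rel N lam S f g" "continuous_on {0..1} g"
proof -
  let ?I = "\<lambda>i. {(real i - 1) / real N .. real i / real N}"
  let ?X = "top_of_set {0..1::real}"
  have cell: "?I i \<subseteq> {0..1}" if "i \<in> {1..N}" for i
    using cell_subset_unit_interval[OF that] .
  obtain g where g: "continuous_map ?X euclidean g"
    "\<And>x i. i \<in> {1..N} \<Longrightarrow> x \<in> topspace ?X \<inter> ?I i \<Longrightarrow> g x = cell_value N lam S f i x"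
  proof (rule pasting_lemma_exists_closed[of "{1..N}" ?X ?I euclidean "cell_value N lam S f"])
    show "topspace ?X \<subseteq> \<Union> (?I ` {1..N})"
    proof
      fix x assume "x \<in> topspace ?X"
      then have "x \<in> {0..1}" by simp
      with \<open>N > 0\<close> obtain i where "i \<in> {1..N}" "x \<in> ?I i" by (rule unit_interval_covered)
      then show "x \<in> \<Union> (?I ` {1..N})" by blast
    qed
    show "closedin ?X (?I i)" if "i \<in> {1..N}" for i
      using cell[OF that] by (intro closed_subset) auto
    show "continuous_map (subtopology ?X (?I i)) euclidean (cell_value N lam S f i)"
      if "i \<in> {1..N}" for i
      using continuous_on_cell_value[where lam = lam and S = S, OF \<open>even N\<close> that lam[OF that] S[OF that] f(1)] cell[OF that]
      by (simp add: subtopology_subtopology Int_absorb1 del: Int_atLeastAtMost)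
    show "cell_value N lam S f i x = cell_value N lam S f k x"
      if "i \<in> {1..N}" "k \<in> {1..N}" "x \<in> topspace ?X \<inter> ?I i \<inter> ?I k" for i k x
      using cell_values_agree[OF \<open>even N\<close> J f(2) that(1,2)] that(3) by blast
  next
    show "finite {1..N}" by simp
  next
    fix g
    assume "continuous_map ?X euclidean g"
      "\<And>x i. i \<in> {1..N} \<Longrightarrow> x \<in> topspace ?X \<inter> ?I i \<Longrightarrow> g x = cell_value N lam S f i x"
    then show thesis by (rule that)
  qed
  show ?thesis
  proof
    show "Phi_rel N lam S f (restrict g {0..1})"
      unfolding Phi_rel_iff_cell_value
    proof (intro conjI ballI)
      fix i x assume i: "i \<in> {1..N}" and x: "x \<in> ?I i"
      then have "x \<in> {0..1}" using cell by blast
      then show "restrict g {0..1} x = cell_value N lam S f i x" using g(2)[OF i] x by simp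
    qed simp
    show "continuous_on {0..1} (restrict g {0..1})"
      by (rule continuous_on_eq[of _ g]) (use g(1) in auto)
  qed
qed

text \<open>Every knot \<open>x\<^sub>2\<^sub>j\<close> with \<open>j \<ge> 1\<close> is the right end of the cell \<open>2j\<close>; the knot \<open>0\<close> is only
  available as the left end of the first cell.\<close>

lemma Phi_rel_interpolates:
  assumes "N > 0" "even N" "property_J N y lam S"
    and "\<And>j. j \<le> N div 2 \<Longrightarrow> f (knot N (2 * j)) = y j"
    and "Phi_rel N lam S f g" "j \<le> N div 2"
  shows "g (knot N (2 * j)) = y j"
proof -
  note knots = cell_values_at_knots[OF assms(3,4)]
  have g: "g x = cell_value N lam S f i x"
    if "i \<in> {1..N}" "x \<in> {(real i - 1) / real N .. real i / real N}" for i x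
    using assms(5) that by (simp add: Phi_rel_iff_cell_value)
  show ?thesis
  proof (cases "j = 0")
    case True
    have "1 \<in> {1..N div 2}" using assms(1,2) by (auto elim!: evenE)
    then show ?thesis using knots(1)[of 1] g[of 1 0] True assms(1) by (simp add: knot_def)
  next
    case False
    then have "2 * j \<in> {1..N}" using assms(2,6) by auto
    then show ?thesis
      using knots(2)[of j] g[of "2 * j" "knot N (2 * j)"] False assms(6)
      by (simp add: knot_def divide_right_mono)
  qed
qed

lemma mspace_interp_space_iff:
  "f \<in> mspace (interp_space N y) \<longleftrightarrow>
     f \<in> extensional {0..1} \<and> continuous_on {0..1} f \<and> (\<forall>j \<le> N div 2. f (knot N (2 * j)) = y j)"
  by (simp add: mspace_interp_space)

lemma Phi_rel_in_interp_space:
  assumes "even N" "N > 0"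
    and "\<And>i. i \<in> {1..N} \<Longrightarrow> continuous_on (subdom N i) (lam i)"
    and "\<And>i. i \<in> {1..N} \<Longrightarrow> continuous_on (subdom N i) (S i)"
    and "property_J N y lam S"
    and f: "f \<in> mspace (interp_space N y)"
  obtains g where "Phi_rel N lam S f g" "g \<in> mspace (interp_space N y)"
proof -
  have f': "continuous_on {0..1} f" "\<And>j. j \<le> N div 2 \<Longrightarrow> f (knot N (2 * j)) = y j"
    using f by (auto simp: mspace_interp_space_iff)
  obtain g where g: "Phi_rel N lam S f g" "continuous_on {0..1} g"
    by (rule Phi_rel_continuous_solution[where lam = lam and S = S and f = f, OF assms(1-5) f'])
  then have "g \<in> mspace (interp_space N y)"
    using Phi_rel_interpolates[OF assms(2,1,5) f'(2) g(1)]
    by (auto simp: mspace_interp_space_iff Phi_rel_def)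
  with g(1) show ?thesis by (rule that)
qed

section \<open>The contraction estimate\<close>

lemma abs_le_sup_norm:
  assumes "compact X" "continuous_on X f" "x \<in> X"
  shows "\<bar>f x\<bar> \<le> sup_norm X f"
proof -
  have "compact ((\<lambda>x. \<bar>f x\<bar>) ` X)"
    using assms by (intro compact_continuous_image continuous_intros)
  then have "bdd_above ((\<lambda>x. \<bar>f x\<bar>) ` X)"
    by (intro bounded_imp_bdd_above compact_imp_bounded)
  then show ?thesis unfolding sup_norm_def using assms(3) by (rule cSUP_upper2) auto
qed

lemma interp_space_mdist_upper:
  assumes "f \<in> mspace (interp_space N y)" "g \<in> mspace (interp_space N y)" "x \<in> {0..1}"
  shows "\<bar>f x - g x\<bar> \<le> mdist (interp_space N y) f g"
  unfolding mdist_interp_space[OF assms(1,2)] sup_norm_def[symmetric]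
  using assms by (intro abs_le_sup_norm continuous_intros) (auto simp: mspace_interp_space_iff)

text \<open>On a cell, \<open>\<Phi> f - \<Phi> f'\<close> is \<open>S\<^sub>i (f - f')\<close> read in the coordinate \<open>t = u\<^sub>i\<^sup>-\<^sup>1(x)\<close>.\<close>

lemma Phi_rel_Lipschitz:
  assumes "even N" "N > 0"
    and "f \<in> mspace (interp_space N y)" "f' \<in> mspace (interp_space N y)"
    and "g \<in> mspace (interp_space N y)" "g' \<in> mspace (interp_space N y)"
    and "Phi_rel N lam S f g" "Phi_rel N lam S f' g'"
    and S: "\<And>i t. i \<in> {1..N} \<Longrightarrow> t \<in> subdom N i \<Longrightarrow> \<bar>S i t\<bar> \<le> k"
  shows "mdist (interp_space N y) g g' \<le> k * mdist (interp_space N y) f f'"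
  unfolding mdist_interp_space[OF assms(5,6)]
proof (rule cSUP_least)
  fix x :: real assume "x \<in> {0..1}"
  with \<open>N > 0\<close> obtain i where i: "i \<in> {1..N}" "x \<in> {(real i - 1) / real N .. real i / real N}"
    by (rule unit_interval_covered)
  define t where "t = umap_inv N i x"
  have t: "t \<in> subdom N i" using umap_inv_in_subdom i unfolding t_def by auto
  have t01: "t \<in> {0..1}" using t subdom_subset_unit_interval[OF assms(1) i(1)] by blast
  have "g x - g' x = S i t * (f t - f' t)"
    using i assms(7,8) by (simp add: Phi_rel_iff_cell_value cell_value_def t_def algebra_simps)
  then have "\<bar>g x - g' x\<bar> = \<bar>S i t\<bar> * \<bar>f t - f' t\<bar>" by (simp add: abs_mult)
  also have "\<dots> \<le> k * mdist (interp_space N y) f f'"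
    using S[OF i(1) t] interp_space_mdist_upper[OF assms(3,4) t01]
    by (intro mult_mono) auto
  finally show "\<bar>g x - g' x\<bar> \<le> k * mdist (interp_space N y) f f'" .
qed simp

section \<open>The interpolation space is complete and inhabited\<close>

lemma interp_space_nonempty:
  assumes "N > 0"
  shows "mspace (interp_space N y) \<noteq> {}"
proof -
  \<comment> \<open>The \<open>j\<close>-th hat function is \<open>1\<close> at \<open>x\<^sub>2\<^sub>j\<close> and vanishes at all other even knots.\<close>
  define h where "h x = (\<Sum>j\<le>N div 2. y j * max 0 (1 - \<bar>real N * x / 2 - real j\<bar>))" for x
  have "continuous_on {0..1} h"
    unfolding h_def by (intro continuous_intros) simp_all
  moreover have "h (knot N (2 * m)) = y m" if "m \<le> N div 2" for m
  proof -
    have *: "max 0 (1 - \<bar>real m - real j\<bar>) = (if j = m then 1 else 0)" for j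
      by (auto simp: max_def)
    have "real N * knot N (2 * m) / 2 = real m" using assms by (simp add: knot_def)
    then show ?thesis using that unfolding h_def by (simp add: * if_distrib cong: if_cong)
  qed
  moreover from calculation(1) have "continuous_on {0..1} (restrict h {0..1})"
    by (rule continuous_on_eq) simp
  ultimately have "restrict h {0..1} \<in> mspace (interp_space N y)"
    unfolding mspace_interp_space_iff using even_knot_in_unit_interval by simp
  then show ?thesis by blast
qed

text \<open>Evaluation at a knot is \<open>1\<close>-Lipschitz for the supremum metric, so the interpolation
  conditions survive limits and define a closed subset of the complete space \<open>C[0,1]\<close>.\<close>

lemma mcomplete_interp_space: "mcomplete_of (interp_space N y)"
proof -
  interpret C: Metric_space "mspace C01" "mdist C01" by (rule Metric_space_mspace_mdist)
  interpret Submetric "mspace C01" "mdist C01" "mspace (interp_space N y)"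
    by unfold_locales (simp add: interp_space_def del: mspace_cfunspace)
  have complete: "C.mcomplete"
    using Met_TC.mcomplete_cfunspace[where ?'a = real, of "top_of_set {0..1::real}"]
    by (simp add: mcomplete_of_def Met_TC.Self_def euclidean_metric_def complete_UNIV
        del: mspace_cfunspace)
  have "closedin C.mtopology (mspace (interp_space N y))"
    unfolding C.metric_closedin_iff_sequentially_closed
  proof (intro conjI allI impI subset)
    fix \<sigma> g
    assume *: "range \<sigma> \<subseteq> mspace (interp_space N y) \<and> limitin C.mtopology \<sigma> g sequentially"
    then have g: "g \<in> mspace C01" and lim: "(\<lambda>n. mdist C01 (\<sigma> n) g) \<longlonglongrightarrow> 0"
      using C.limitin_mspace C.limitin_metric_dist_null by blast+
    have "g (knot N (2 * j)) = y j" if j: "j \<le> N div 2" for j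
    proof -
      have "\<bar>y j - g (knot N (2 * j))\<bar> \<le> mdist C01 (\<sigma> n) g" for n
      proof -
        have "\<sigma> n \<in> mspace (interp_space N y)" using * by auto
        moreover from this have "\<sigma> n \<in> mspace C01" using subset by blast
        moreover from calculation have "\<sigma> n (knot N (2 * j)) = y j"
          using j by (simp add: mspace_interp_space_iff)
        ultimately show ?thesis
          using mdist_cfunspace_imp_mdist_le[OF _ g order_refl, of "\<sigma> n" "knot N (2 * j)"]
            even_knot_in_unit_interval[OF j] by (simp add: dist_real_def)
      qed
      then have "\<bar>y j - g (knot N (2 * j))\<bar> \<le> 0"
        using lim by (intro LIMSEQ_le_const) auto
      then show ?thesis by simp
    qed
    with g show "g \<in> mspace (interp_space N y)"
      by (simp add: interp_space_def)
  qed
  then have "sub.mcomplete" using complete closedin_mcomplete_imp_mcomplete by blast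
  then show ?thesis by (simp add: mcomplete_of_def interp_space_def)
qed

section \<open>The fixed point\<close>

lemma contraction_unique_fixed_point:
  assumes "mcomplete_of m" "mspace m \<noteq> {}" "contraction m T"
  shows "\<exists>!x. x \<in> mspace m \<and> T x = x"
proof -
  interpret Metric_space "mspace m" "mdist m" by simp
  obtain k where T: "T \<in> mspace m \<rightarrow> mspace m" and k: "k < 1"
    "\<And>f g. f \<in> mspace m \<Longrightarrow> g \<in> mspace m \<Longrightarrow> mdist m (T f) (T g) \<le> k * mdist m f g"
    using assms(3) unfolding contraction_def by blast
  obtain x where x: "x \<in> mspace m" "T x = x"
    using Banach_fixedpoint_thm[of T k] assms(1,2) T k unfolding mcomplete_of_def by blast
  show ?thesis
  proof (rule ex1I)
    show "x \<in> mspace m \<and> T x = x" using x by simp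
    fix z assume "z \<in> mspace m \<and> T z = z"
    then show "z = x" using contraction_imp_unique_fixpoint[of T z x k] x T k by auto
  qed
qed

theorem theorem8:
  fixes N :: nat and y :: "nat \<Rightarrow> real" and lam S :: "nat \<Rightarrow> real \<Rightarrow> real"
  assumes "even N" and "N > 0"
    and "\<And>i. i \<in> {1..N} \<Longrightarrow> continuous_on (subdom N i) (lam i)"
    and "\<And>i. i \<in> {1..N} \<Longrightarrow> continuous_on (subdom N i) (S i)"
    and "property_J N y lam S"
  shows "(\<forall>f \<in> mspace (interp_space N y). \<exists>!g. Phi_rel N lam S f g) \<and>
    Phi N lam S \<in> mspace (interp_space N y) \<rightarrow> mspace (interp_space N y) \<and>
    (Max ((\<lambda>i. sup_norm (subdom N i) (S i)) ` {1..N}) < 1 \<longrightarrow>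
      contraction (interp_space N y) (Phi N lam S) \<and>
      (\<exists>!f. f \<in> mspace (interp_space N y) \<and> Phi N lam S f = f \<and>
            (\<forall>j \<le> N div 2. f (knot N (2 * j)) = y j)))"
proof -
  let ?M = "mspace (interp_space N y)"
  let ?k = "Max ((\<lambda>i. sup_norm (subdom N i) (S i)) ` {1..N})"
  have Phi: "Phi_rel N lam S f (Phi N lam S f) \<and> Phi N lam S f \<in> ?M" if f: "f \<in> ?M" for f
  proof -
    obtain g where "Phi_rel N lam S f g" "g \<in> ?M"
      by (rule Phi_rel_in_interp_space[where lam = lam and S = S, OF assms f])
    then show ?thesis using Phi_eqI[OF \<open>N > 0\<close>] by simp
  qed
  have k: "\<bar>S i t\<bar> \<le> ?k" if "i \<in> {1..N}" "t \<in> subdom N i" for i t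
  proof -
    have "\<bar>S i t\<bar> \<le> sup_norm (subdom N i) (S i)"
      using assms(4) that by (intro abs_le_sup_norm) (auto simp: subdom_def Let_def)
    also have "\<dots> \<le> ?k" using that(1) by (intro Max_ge) auto
    finally show ?thesis .
  qed
  have contr: "contraction (interp_space N y) (Phi N lam S)" if "?k < 1"
  proof -
    \<comment> \<open>A contraction constant must be nonnegative; any value of \<open>S\<^sub>1\<close> witnesses this.\<close>
    have "0 \<in> {0 / real N .. 1 / real N}" by simp
    then have "umap_inv N 1 0 \<in> subdom N 1" by (intro umap_inv_in_subdom) auto
    then have "0 \<le> ?k" using k[of 1] \<open>N > 0\<close> by (fastforce intro: order_trans[OF abs_ge_zero])
    moreover have "mdist (interp_space N y) (Phi N lam S f) (Phi N lam S g)
        \<le> ?k * mdist (interp_space N y) f g" if "f \<in> ?M" "g \<in> ?M" for f g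
      using Phi_rel_Lipschitz[OF assms(1,2) that] Phi that k by blast
    ultimately show ?thesis using that Phi unfolding contraction_def by blast
  qed
  have "\<exists>!f. f \<in> ?M \<and> Phi N lam S f = f \<and> (\<forall>j \<le> N div 2. f (knot N (2 * j)) = y j)" if "?k < 1"
    using contraction_unique_fixed_point[OF mcomplete_interp_space
        interp_space_nonempty[OF \<open>N > 0\<close>] contr[OF that]]
    by (simp add: mspace_interp_space_iff cong: conj_cong)
  moreover have "\<exists>!g. Phi_rel N lam S f g" if "f \<in> ?M" for f
    using Phi[OF that] Phi_rel_unique[OF \<open>N > 0\<close>] by blast
  ultimately show ?thesis using Phi contr by blast
qed

end
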